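(* Let $G$ be a finite graph and $f:\mathbb{R}\to\mathbb{R}$ a non-constant odd real-analytic function. Let $\sigma\in\mathrm{Aut}(G)$ and suppose that a point $x\in X_{G,f}$ is fixed by $\sigma$. Then either $x$ is a singular point of $X_{G,f}$, or $x$ is contained in a $\sigma$-invariant manifold of equilibria (i.e. a $\sigma$-invariant manifold contained in $X_{G,f}$).
   Context: $G$ is a finite simple undirected graph with vertex set $V$. Fix an arbitrary orientation of each edge and let $E\subseteq V\times V$ be the set of oriented edges. The incidence matrix $B:\mathbb{R}^E\to\mathbb{R}^V$ has entries $b_{i,(j,k)}=\delta_{ik}-\delta_{ij}$. Set $\mathrm{H}_1(G)=\mathrm{Ker}(B)\subseteq\mathbb{R}^E$. With $\mathbf{f}:\mathbb{R}^E\to\mathbb{R}^E$ applying $f$ to each component, $X_{G,f}=\mathbf{f}^{-1}(\mathrm{H}_1(G))\cap\mathrm{H}_1(G)^\perp\subseteq\mathbb{R}^E$; it is the set of equilibria, up to translations by $\mathrm{Ker}(B^{\mathsf T})$, of $\dot x_i=\sum_{j\in N(i)}f(x_j-x_i)$, $i\in V$. $\mathrm{Aut}(G)$ is the group of bijections $V\to V$ preserving adjacency. It acts on $\mathbb{R}^V$ by permuting coordinates, $(\sigma.x)_i=x_{\sigma^{-1}(i)}$. It acts correspondingly on $\mathbb{R}^E$ by permuting the coordinates according to the action of $\sigma$ on edges, with a change of sign of a coordinate whenever $\sigma$ does not preserve the chosen orientation of the edge (so that $x\mapsto B^{\mathsf T}x$ is equivariant); this action maps $X_{G,f}$ to itself.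 A point $x\in X_{G,f}$ is regular if $X_{G,f}$ is a manifold in a neighborhood of $x$, and singular otherwise. *)

theory Defs
  imports "HOL-Analysis.Analysis"
begin

section \<open>Graphs, orientations and automorphisms\<close>

text \<open>The vertex set is the finite type \<open>'v\<close>; \<open>A\<close> is the adjacency relation.\<close>

definition simple_graph :: "('v \<times> 'v) set \<Rightarrow> bool" where
  "simple_graph A \<longleftrightarrow> sym A \<and> irrefl A"

text \<open>\<open>E\<close> contains exactly one of \<open>(i, j)\<close> and \<open>(j, i)\<close> for every edge, and nothing else.\<close>

definition orientation :: "('v \<times> 'v) set \<Rightarrow> ('v \<times> 'v) set \<Rightarrow> bool" where
  "orientation A E \<longleftrightarrow> E \<union> E\<inverse> = A \<and> E \<inter> E\<inverse> = {}"

definition Aut :: "('v \<times> 'v) set \<Rightarrow> ('v \<Rightarrow> 'v) set" where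
  "Aut A = {\<sigma>. bij \<sigma> \<and> (\<forall>i j. (\<sigma> i, \<sigma> j) \<in> A \<longleftrightarrow> (i, j) \<in> A)}"


section \<open>The set \<open>X\<^sub>G\<^sub>,\<^sub>f\<close>\<close>

text \<open>Since \<open>E\<close> is a set rather than a type, \<open>\<real>\<^sup>E\<close> is realised as the coordinate subspace of
  \<open>\<real>\<^bsup>V \<times> V\<^esup>\<close> of vectors supported on \<open>E\<close>.\<close>

definition edge_space :: "('v::finite \<times> 'v) set \<Rightarrow> (real ^ ('v \<times> 'v)) set" where
  "edge_space E = {x. \<forall>e. e \<notin> E \<longrightarrow> x $ e = 0}"

definition incidence :: "('v::finite \<times> 'v) set \<Rightarrow> real ^ ('v \<times> 'v) ^ 'v" where
  "incidence E = (\<chi> i e. if e \<in> E then of_bool (i = snd e) - of_bool (i = fst e) else 0)"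

definition H1 :: "('v::finite \<times> 'v) set \<Rightarrow> (real ^ ('v \<times> 'v)) set" where
  "H1 E = {x \<in> edge_space E. incidence E *v x = 0}"

definition edge_map ::
    "('v::finite \<times> 'v) set \<Rightarrow> (real \<Rightarrow> real) \<Rightarrow> real ^ ('v \<times> 'v) \<Rightarrow> real ^ ('v \<times> 'v)" where
  "edge_map E f x = (\<chi> e. if e \<in> E then f (x $ e) else 0)"

definition equilibrium_set :: "('v::finite \<times> 'v) set \<Rightarrow> (real \<Rightarrow> real) \<Rightarrow> (real ^ ('v \<times> 'v)) set" where
  "equilibrium_set E f = {x \<in> edge_space E. edge_map E f x \<in> H1 E \<and> x \<in> orthogonal_comp (H1 E)}"


section \<open>The action of automorphisms\<close>

definition vertex_act :: "('v::finite \<Rightarrow> 'v) \<Rightarrow> real ^ 'v \<Rightarrow> real ^ 'v" where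
  "vertex_act \<sigma> y = (\<chi> i. y $ inv \<sigma> i)"

text \<open>If the preimage of an oriented edge is not itself in \<open>E\<close>, its reversal is, and the
  coordinate changes sign.\<close>

definition edge_act ::
    "('v::finite \<times> 'v) set \<Rightarrow> ('v \<Rightarrow> 'v) \<Rightarrow> real ^ ('v \<times> 'v) \<Rightarrow> real ^ ('v \<times> 'v)" where
  "edge_act E \<sigma> x =
     (\<chi> e. if e \<in> E then
              let i = inv \<sigma> (fst e); j = inv \<sigma> (snd e)
              in if (i, j) \<in> E then x $ (i, j) else - x $ (j, i)
            else 0)"

lemma transpose_incidence_nth:
  "(transpose (incidence E) *v y) $ e = (if e \<in> E then y $ snd e - y $ fst e else 0)"
proof -
  have "(transpose (incidence E) *v y) $ e =
      (\<Sum>i\<in>UNIV. if e \<in> E then (of_bool (i = snd e) - of_bool (i = fst e)) * y $ i else 0)"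
    by (auto simp: matrix_vector_mult_def transpose_def incidence_def intro!: sum.cong)
  also have "\<dots> = (if e \<in> E then y $ snd e - y $ fst e else 0)"
    by (simp add: left_diff_distrib sum_subtractf of_bool_def if_distrib[of "\<lambda>a. a * _"]
        cong: if_cong)
  finally show ?thesis .
qed

lemma edge_act_equivariant:
  assumes "orientation A E" "\<sigma> \<in> Aut A"
  shows "edge_act E \<sigma> (transpose (incidence E) *v y)
       = transpose (incidence E) *v vertex_act \<sigma> y"
proof -
  have "(inv \<sigma> j, inv \<sigma> i) \<in> E" if "(i, j) \<in> E" "(inv \<sigma> i, inv \<sigma> j) \<notin> E" for i j
  proof -
    have "surj \<sigma>" and A: "(\<sigma> a, \<sigma> b) \<in> A \<longleftrightarrow> (a, b) \<in> A" for a b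
      using assms(2) by (auto simp: Aut_def bij_def)
    have "(\<sigma> (inv \<sigma> i), \<sigma> (inv \<sigma> j)) \<in> A"
      using that(1) assms(1) \<open>surj \<sigma>\<close> by (auto simp: orientation_def surj_f_inv_f)
    then show ?thesis
      using that(2) assms(1) unfolding A by (auto simp: orientation_def)
  qed
  then show ?thesis
    by (auto simp: vec_eq_iff edge_act_def transpose_incidence_nth vertex_act_def Let_def
        simp del: transpose_matrix_vector)
qed


section \<open>Manifolds and regular points\<close>

text \<open>\<open>f\<close> is \<open>C\<^sup>k\<close> on the open set \<open>U\<close>, by recursion through directional derivatives.\<close>

primrec C_k :: "nat \<Rightarrow> 'a::euclidean_space set \<Rightarrow> ('a \<Rightarrow> 'b::euclidean_space) \<Rightarrow> bool" where
  "C_k 0 U f \<longleftrightarrow> continuous_on U f"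
| "C_k (Suc k) U f \<longleftrightarrow>
     (\<exists>f'. (\<forall>x\<in>U. (f has_derivative f' x) (at x)) \<and> (\<forall>v. C_k k U (\<lambda>x. f' x v)))"

definition smooth_on :: "'a::euclidean_space set \<Rightarrow> ('a \<Rightarrow> 'b::euclidean_space) \<Rightarrow> bool" where
  "smooth_on U f \<longleftrightarrow> (\<forall>k. C_k k U f)"

text \<open>Embedded smooth submanifold of dimension \<open>d\<close>: locally straightened to a \<open>d\<close>-dimensional
  linear subspace \<open>L\<close> by an ambient diffeomorphism. The empty set qualifies for every \<open>d\<close>, and
  the submanifolds of dimension 0 are the discrete sets.\<close>

definition submanifold :: "nat \<Rightarrow> 'a::euclidean_space set \<Rightarrow> bool" where
  "submanifold d M \<longleftrightarrow>
     (\<forall>p\<in>M. \<exists>(U :: 'a set) (V :: 'a set) \<phi> \<psi> L.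
        open U \<and> p \<in> U \<and> open V \<and> homeomorphism U V \<phi> \<psi> \<and> smooth_on U \<phi> \<and> smooth_on V \<psi> \<and>
        subspace L \<and> dim L = d \<and> \<phi> ` (U \<inter> M) = V \<inter> L)"

definition regular_point :: "'a::euclidean_space set \<Rightarrow> 'a \<Rightarrow> bool" where
  "regular_point S x \<longleftrightarrow> x \<in> S \<and> (\<exists>W d. open W \<and> x \<in> W \<and> submanifold d (S \<inter> W))"

definition singular_point :: "'a::euclidean_space set \<Rightarrow> 'a \<Rightarrow> bool" where
  "singular_point S x \<longleftrightarrow> x \<in> S \<and> \<not> regular_point S x"


section \<open>Real-analytic functions\<close>

definition real_analytic :: "(real \<Rightarrow> real) \<Rightarrow> bool" where
  "real_analytic f \<longleftrightarrow>
     (\<forall>a. \<exists>c r. r > 0 \<and> (\<forall>t. \<bar>t - a\<bar> < r \<longrightarrow> (\<lambda>n. c n * (t - a) ^ n) sums f t))"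

end

theory Submission
  imports Defs
begin

text \<open>The automorphism acts on \<open>\<real>\<^sup>E\<close> by a linear isometry preserving the equilibrium set. Hence a
  ball around a fixed point cuts an invariant, relatively open piece out of the equilibrium set,
  and at a regular point this piece is a manifold once the ball is small enough.\<close>

section \<open>Open subsets of submanifolds\<close>

lemma C_k_subset: "C_k k U f \<Longrightarrow> V \<subseteq> U \<Longrightarrow> C_k k V f"
\<comment> \<open>\<open>f\<close> must vary: the recursion passes to the directional derivatives of
  \<open>f\<close>.\<close>
proof (induction k arbitrary: f)
  case 0
  then show ?case by (auto intro: continuous_on_subset)
next
  case (Suc k)
  from Suc.prems(1) obtain f' where
    "\<forall>x\<in>U. (f has_derivative f' x) (at x)" "\<forall>v. C_k k U (\<lambda>x. f' x v)"
    by auto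
  with Suc.IH Suc.prems(2) show ?case
    by (auto intro!: exI[of _ f'])
qed

lemma smooth_on_subset: "smooth_on U f \<Longrightarrow> V \<subseteq> U \<Longrightarrow> smooth_on V f"
  by (auto simp: smooth_on_def intro: C_k_subset)

text \<open>A straightening chart at \<open>p\<close> may be restricted to
  \<open>U \<inter> W\<close>. A homeomorphism is an open map, so the image is open in
  \<open>V\<close>, hence open in the whole space.\<close>

lemma submanifold_Int_open:
  fixes M W :: "'a::euclidean_space set"
  assumes "submanifold d M" "open W"
  shows "submanifold d (M \<inter> W)"
  unfolding submanifold_def
proof
  fix p assume p: "p \<in> M \<inter> W"
  then have "p \<in> M" ..
  from bspec[OF assms(1)[unfolded submanifold_def] this]
  obtain U V :: "'a set" and \<phi> \<psi> L where
    U: "open U" "p \<in> U" and V: "open V" and hom: "homeomorphism U V \<phi> \<psi>"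
    and sm: "smooth_on U \<phi>" "smooth_on V \<psi>"
    and L: "subspace L" "dim L = d" "\<phi> ` (U \<inter> M) = V \<inter> L"
    by (elim exE conjE) (rule that; assumption)
  define U' V' where "U' = U \<inter> W" and "V' = \<phi> ` U'"
  have sub: "U' \<subseteq> U" "V' \<subseteq> V"
    using hom by (auto simp: U'_def V'_def homeomorphism_def)
  have hom': "homeomorphism U' V' \<phi> \<psi>"
    using hom sub by (rule homeomorphism_of_subsets) (simp add: V'_def)
  have "openin (top_of_set V) V'"
    unfolding V'_def using homeomorphism_imp_open_map[OF hom] assms(2)
    by (auto simp: U'_def)
  then have "open V'"
    using V by (simp add: openin_open_eq)
  moreover have "\<phi> ` (U' \<inter> (M \<inter> W)) = V' \<inter> L"
  proof -
    \<comment> \<open>Injectivity makes taking images commute with intersections, so the old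
      flattening \<open>V \<inter> L\<close> is merely cut down to \<open>V'\<close>.\<close>
    have inj: "inj_on \<phi> U"
      using hom by (metis homeomorphism_def inj_on_inverseI)
    have "\<phi> ` (U' \<inter> (M \<inter> W)) = \<phi> ` (U' \<inter> (U \<inter> M))"
      by (auto simp: U'_def)
    also have "\<dots> = V' \<inter> (V \<inter> L)"
      using inj_on_image_Int[OF inj sub(1), of "U \<inter> M"] L(3) by (simp add: V'_def)
    finally show ?thesis
      using sub(2) by blast
  qed
  ultimately show "\<exists>(U :: 'a set) (V :: 'a set) \<phi> \<psi> L.
        open U \<and> p \<in> U \<and> open V \<and> homeomorphism U V \<phi> \<psi> \<and> smooth_on U \<phi> \<and> smooth_on V \<psi> \<and>
        subspace L \<and> dim L = d \<and> \<phi> ` (U \<inter> (M \<inter> W)) = V \<inter> L"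
    using U p assms(2) hom' sub sm L(1,2)
    by (intro exI[of _ U'] exI[of _ V'] exI[of _ \<phi>] exI[of _ \<psi>] exI[of _ L])
      (auto simp: U'_def intro: smooth_on_subset)
qed

section \<open>The action on the edge space\<close>

text \<open>Through the antisymmetric extension to all ordered pairs, the signed action on \<open>\<real>\<^sup>E\<close>
  becomes plain reindexing.\<close>

definition antisym_ext :: "('v::finite \<times> 'v) set \<Rightarrow> real ^ ('v \<times> 'v) \<Rightarrow> 'v \<times> 'v \<Rightarrow> real" where
  "antisym_ext E x e =
     (if e \<in> E then x $ e else if prod.swap e \<in> E then - x $ prod.swap e else 0)"

text \<open>The factor 2 arises because each edge occurs in both directions, and reversal flips the
  sign of both factors. Pairs that are not edges contribute 0; support of one vector in
  \<open>E\<close> suffices for this.\<close>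

lemma inner_eq_sum_antisym_ext:
  assumes "orientation A E" "x \<in> edge_space E"
  shows "2 * inner x y = (\<Sum>e\<in>UNIV. antisym_ext E x e * antisym_ext E y e)"
proof -
  have noswap: "(j, i) \<notin> E" if "(i, j) \<in> E" for i j
    using assms(1) that by (auto simp: orientation_def)
  have swap: "e \<in> prod.swap ` E \<longleftrightarrow> prod.swap e \<in> E" for e
    by (cases e) force
  have "(\<Sum>e\<in>UNIV. antisym_ext E x e * antisym_ext E y e)
      = (\<Sum>e\<in>E \<union> prod.swap ` E. antisym_ext E x e * antisym_ext E y e)"
    by (rule sum.mono_neutral_right) (simp_all add: antisym_ext_def swap)
  also have "\<dots> = (\<Sum>e\<in>E. antisym_ext E x e * antisym_ext E y e)
      + (\<Sum>e\<in>prod.swap ` E. antisym_ext E x e * antisym_ext E y e)"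
    using noswap by (intro sum.union_disjoint) auto
  also have "(\<Sum>e\<in>prod.swap ` E. antisym_ext E x e * antisym_ext E y e)
      = (\<Sum>e\<in>E. x $ e * y $ e)"
    using noswap by (subst sum.reindex) (auto simp: antisym_ext_def intro!: sum.cong)
  also have "(\<Sum>e\<in>E. antisym_ext E x e * antisym_ext E y e) = (\<Sum>e\<in>E. x $ e * y $ e)"
    by (simp add: antisym_ext_def)
  also have "(\<Sum>e\<in>E. x $ e * y $ e) = inner x y"
    using assms(2) unfolding inner_vec_def
    by (intro sum.mono_neutral_cong_left) (auto simp: edge_space_def)
  finally show ?thesis by simp
qed

lemma edge_act_in_edge_space: "edge_act E \<sigma> x \<in> edge_space E"
  by (simp add: edge_act_def edge_space_def)

lemma inv_Aut:
  assumes "\<sigma> \<in> Aut A"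
  shows "inv \<sigma> \<in> Aut A"
proof -
  have "bij \<sigma>" and A: "(\<sigma> i, \<sigma> j) \<in> A \<longleftrightarrow> (i, j) \<in> A" for i j
    using assms by (auto simp: Aut_def)
  then have "(inv \<sigma> i, inv \<sigma> j) \<in> A \<longleftrightarrow> (i, j) \<in> A" for i j
    using A[of "inv \<sigma> i" "inv \<sigma> j"] by (simp add: bij_is_surj surj_f_inv_f)
  with \<open>bij \<sigma>\<close> show ?thesis
    by (simp add: Aut_def bij_imp_bij_inv)
qed

text \<open>The sign in \<open>edge_act\<close> is exactly the one that the extension picks up on a
  reversed edge. Off the edges both sides vanish, since \<open>inv \<sigma>\<close> preserves
  non-adjacency too.\<close>

lemma antisym_ext_edge_act:
  assumes "orientation A E" "\<sigma> \<in> Aut A"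
  shows "antisym_ext E (edge_act E \<sigma> x) (i, j) = antisym_ext E x (inv \<sigma> i, inv \<sigma> j)"
proof -
  have A: "(inv \<sigma> i, inv \<sigma> j) \<in> A \<longleftrightarrow> (i, j) \<in> A" for i j
    using inv_Aut[OF assms(2)] by (simp add: Aut_def)
  have E: "(a, b) \<in> A \<longleftrightarrow> (a, b) \<in> E \<or> (b, a) \<in> E" "(a, b) \<in> E \<Longrightarrow> (b, a) \<notin> E" for a b
    using assms(1) by (auto simp: orientation_def)
  show ?thesis
    using A[of i j] E(2)[of i j] E(2)[of "inv \<sigma> i" "inv \<sigma> j"] E(1)[of i j]
      E(1)[of "inv \<sigma> i" "inv \<sigma> j"]
    by (auto simp: antisym_ext_def edge_act_def Let_def)
qed

lemma edge_space_eqI: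
  assumes "x \<in> edge_space E" "y \<in> edge_space E"
    and "\<And>i j. antisym_ext E x (i, j) = antisym_ext E y (i, j)"
  shows "x = y"
proof -
  have "x $ e = y $ e" for e
    using assms(3)[of "fst e" "snd e"] assms(1,2)
    by (cases "e \<in> E") (simp_all add: antisym_ext_def edge_space_def del: split_paired_All)
  then show ?thesis
    by (simp add: vec_eq_iff)
qed

lemma edge_act_inv:
  assumes "orientation A E" "\<sigma> \<in> Aut A" "x \<in> edge_space E"
  shows "edge_act E \<sigma> (edge_act E (inv \<sigma>) x) = x"
proof -
  have "bij \<sigma>"
    using assms(2) by (simp add: Aut_def)
  then show ?thesis
    using assms inv_Aut[OF assms(2)]
    by (intro edge_space_eqI[of _ E])
      (simp_all add: edge_act_in_edge_space antisym_ext_edge_act inv_inv_eq bij_is_surj surj_f_inv_f)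
qed

text \<open>Written as a sum over all ordered pairs, the inner product is merely reordered by the
  bijection that \<open>inv \<sigma>\<close> induces on pairs.\<close>

lemma inner_edge_act:
  assumes "orientation A E" "\<sigma> \<in> Aut A" "x \<in> edge_space E"
  shows "inner (edge_act E \<sigma> x) (edge_act E \<sigma> y) = inner x y"
proof -
  have "bij (inv \<sigma>)"
    using inv_Aut[OF assms(2)] by (simp add: Aut_def)
  then have "bij (map_prod (inv \<sigma>) (inv \<sigma>))"
    using bij_betw_map_prod[of "inv \<sigma>" UNIV UNIV "inv \<sigma>" UNIV UNIV] by simp
  then have "(\<Sum>e\<in>UNIV. antisym_ext E x (map_prod (inv \<sigma>) (inv \<sigma>) e)
        * antisym_ext E y (map_prod (inv \<sigma>) (inv \<sigma>) e))
      = (\<Sum>e\<in>UNIV. antisym_ext E x e * antisym_ext E y e)"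
    by (rule sum.reindex_bij_betw)
  moreover have "antisym_ext E (edge_act E \<sigma> z) e
      = antisym_ext E z (map_prod (inv \<sigma>) (inv \<sigma>) e)" for z e
    using antisym_ext_edge_act[OF assms(1,2)] by (cases e) simp
  ultimately have "2 * inner (edge_act E \<sigma> x) (edge_act E \<sigma> y) = 2 * inner x y"
    using inner_eq_sum_antisym_ext[OF assms(1) assms(3), of y]
      inner_eq_sum_antisym_ext[OF assms(1) edge_act_in_edge_space, of \<sigma> x "edge_act E \<sigma> y"]
    by simp
  then show ?thesis by simp
qed

text \<open>The adjoint of an invertible isometry is its inverse. This lets the action be moved onto
  test vectors below.\<close>

lemma inner_edge_act_left:
  assumes "orientation A E" "\<sigma> \<in> Aut A" "x \<in> edge_space E" "y \<in> edge_space E"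
  shows "inner (edge_act E \<sigma> x) y = inner x (edge_act E (inv \<sigma>) y)"
  using inner_edge_act[OF assms(1-3), of "edge_act E (inv \<sigma>) y"] edge_act_inv[OF assms(1,2,4)]
  by simp

lemma dist_edge_act:
  assumes "orientation A E" "\<sigma> \<in> Aut A" "x \<in> edge_space E" "y \<in> edge_space E"
  shows "dist (edge_act E \<sigma> x) (edge_act E \<sigma> y) = dist x y"
proof -
  have "edge_act E \<sigma> x - edge_act E \<sigma> y = edge_act E \<sigma> (x - y)"
    by (simp add: vec_eq_iff edge_act_def Let_def)
  moreover have "x - y \<in> edge_space E"
    using assms(3,4) by (simp add: edge_space_def)
  ultimately show ?thesis
    using inner_edge_act[OF assms(1,2), of "x - y" "x - y"] by (simp add: dist_norm norm_eq)
qed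

section \<open>Invariance of the cycle space and of the equilibrium set\<close>

lemma inner_incidence:
  "inner (incidence E *v x) y = inner x (transpose (incidence E) *v y)"
  using dot_lmul_matrix[of y "incidence E" x] by (simp add: inner_commute)

text \<open>Duality turns the equivariance of the transposed incidence matrix into invariance of the
  kernel: pairing the new boundary with any \<open>y\<close> gives the pairing of the old boundary,
  which is 0, with a permuted \<open>y\<close>.\<close>

lemma edge_act_H1:
  assumes "orientation A E" "\<sigma> \<in> Aut A" "x \<in> H1 E"
  shows "edge_act E \<sigma> x \<in> H1 E"
proof -
  have x: "x \<in> edge_space E" "incidence E *v x = 0"
    using assms(3) by (auto simp: H1_def)
  have "inner (incidence E *v edge_act E \<sigma> x) y = 0" for y
  proof -
    \<comment> \<open>The adjoint formula requires its second argument to be supported on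
      \<open>E\<close>.\<close>
    have "transpose (incidence E) *v y \<in> edge_space E"
      by (simp add: edge_space_def transpose_incidence_nth del: transpose_matrix_vector)
    then have "inner (incidence E *v edge_act E \<sigma> x) y
        = inner x (edge_act E (inv \<sigma>) (transpose (incidence E) *v y))"
      using inner_edge_act_left[OF assms(1,2) x(1)]
      by (simp add: inner_incidence del: transpose_matrix_vector)
    also have "\<dots> = inner (incidence E *v x) (vertex_act (inv \<sigma>) y)"
      using edge_act_equivariant[OF assms(1) inv_Aut[OF assms(2)]]
      by (simp add: inner_incidence del: transpose_matrix_vector)
    finally show ?thesis
      using x(2) by simp
  qed
  then have "incidence E *v edge_act E \<sigma> x = 0"
    by (metis inner_eq_zero_iff)
  then show ?thesis
    by (simp add: H1_def edge_act_in_edge_space)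
qed

text \<open>An odd function applied componentwise commutes with permutations and sign changes of
  coordinates.\<close>

lemma edge_map_edge_act:
  assumes "orientation A E" "\<sigma> \<in> Aut A" and odd: "\<And>t. f (- t) = - f t"
  shows "edge_map E f (edge_act E \<sigma> x) = edge_act E \<sigma> (edge_map E f x)"
proof -
  \<comment> \<open>Needed on non-adjacent pairs, where the extension has the default value
    0.\<close>
  have "f 0 = 0"
    using odd[of 0] by simp
  then have ext: "antisym_ext E (edge_map E f y) e = f (antisym_ext E y e)" for y e
    by (simp add: antisym_ext_def edge_map_def odd)
  have "edge_map E f (edge_act E \<sigma> x) \<in> edge_space E"
    by (simp add: edge_map_def edge_space_def)
  then show ?thesis
    using edge_act_in_edge_space antisym_ext_edge_act[OF assms(1,2)] ext
    by (intro edge_space_eqI[of _ E]) simp_all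
qed

text \<open>Both defining conditions reduce to the invariance of \<open>H1 E\<close>: the nonlinear
  one because \<open>edge_map\<close> commutes with the action, the orthogonality one by moving the
  action to \<open>inv \<sigma>\<close> on the cycle.\<close>

lemma edge_act_equilibrium_set:
  assumes "orientation A E" "\<sigma> \<in> Aut A" "\<And>t. f (- t) = - f t" "x \<in> equilibrium_set E f"
  shows "edge_act E \<sigma> x \<in> equilibrium_set E f"
proof -
  have x: "x \<in> edge_space E" "edge_map E f x \<in> H1 E" "\<And>y. y \<in> H1 E \<Longrightarrow> inner x y = 0"
    using assms(4)
    by (auto simp: equilibrium_set_def orthogonal_comp_def orthogonal_def inner_commute)
  have "inner (edge_act E \<sigma> x) y = 0" if "y \<in> H1 E" for y
  proof -
    have "y \<in> edge_space E"
      using that by (simp add: H1_def)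
    then show ?thesis
      using inner_edge_act_left[OF assms(1,2) x(1)] x(3)
        edge_act_H1[OF assms(1) inv_Aut[OF assms(2)] that] by simp
  qed
  moreover have "edge_map E f (edge_act E \<sigma> x) \<in> H1 E"
    using edge_map_edge_act[of A E \<sigma> f, OF assms(1-3)] edge_act_H1[OF assms(1,2) x(2)] by simp
  ultimately show ?thesis
    by (auto simp: equilibrium_set_def orthogonal_comp_def orthogonal_def inner_commute
        edge_act_in_edge_space)
qed

section \<open>Invariant neighbourhoods of a fixed point\<close>

lemma edge_act_image_equilibrium_set_Int_ball:
  assumes "orientation A E" "\<sigma> \<in> Aut A" "\<And>t. f (- t) = - f t"
    and "x \<in> edge_space E" "edge_act E \<sigma> x = x"
  shows "edge_act E \<sigma> ` (equilibrium_set E f \<inter> ball x r) = equilibrium_set E f \<inter> ball x r"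
    (is "?T ` ?M = ?M")
proof -
  have edge: "y \<in> edge_space E" if "y \<in> equilibrium_set E f" for y
    using that by (simp add: equilibrium_set_def)
  have dist: "dist x (?T y) = dist x y" if "y \<in> edge_space E" for y
    using dist_edge_act[OF assms(1,2,4) that] assms(5) by simp
  show ?thesis
  proof
    show "?T ` ?M \<subseteq> ?M"
      using edge_act_equilibrium_set[of A E \<sigma> f, OF assms(1-3)] edge dist by auto
    show "?M \<subseteq> ?T ` ?M"
    proof
      fix y assume y: "y \<in> ?M"
      \<comment> \<open>The preimage of \<open>y\<close> stays in the ball because the action
        preserves the distance to the fixed point \<open>x\<close>.\<close>
      define z where "z = edge_act E (inv \<sigma>) y"
      have "z \<in> equilibrium_set E f"
        using edge_act_equilibrium_set[of A E "inv \<sigma>" f, OF assms(1) inv_Aut[OF assms(2)] assms(3)] y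
        by (simp add: z_def)
      moreover have "?T z = y"
        using y edge edge_act_inv[OF assms(1,2)] by (simp add: z_def)
      ultimately show "y \<in> ?T ` ?M"
        using y edge dist[of z] by auto
    qed
  qed
qed

theorem lemma3p18:
  fixes A E :: "('v::finite \<times> 'v) set"
    and f :: "real \<Rightarrow> real"
    and \<sigma> :: "'v \<Rightarrow> 'v"
    and x :: "real ^ ('v \<times> 'v)"
  assumes "simple_graph A"
    and "orientation A E"
    and "real_analytic f"
    and "\<And>t. f (- t) = - f t"
    and "\<not> f constant_on UNIV"
    and "\<sigma> \<in> Aut A"
    and "x \<in> equilibrium_set E f"
    and "edge_act E \<sigma> x = x"
  shows "singular_point (equilibrium_set E f) x \<or>
    (\<exists>M d. submanifold d M \<and> x \<in> M \<and> M \<subseteq> equilibrium_set E f \<and> edge_act E \<sigma> ` M = M \<and>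
           openin (top_of_set (equilibrium_set E f)) M)"
proof (cases "regular_point (equilibrium_set E f) x")
  case True
  let ?X = "equilibrium_set E f"
  obtain W d where W: "open W" "x \<in> W" "submanifold d (?X \<inter> W)"
    using True by (auto simp: regular_point_def)
  \<comment> \<open>\<open>W\<close> itself may fail to be invariant, but balls centred at the fixed
    point cut out invariant pieces.\<close>
  obtain r where r: "r > 0" "ball x r \<subseteq> W"
    using W(1,2) open_contains_ball by blast
  have "?X \<inter> W \<inter> ball x r = ?X \<inter> ball x r"
    using r(2) by blast
  then have "submanifold d (?X \<inter> ball x r)"
    using submanifold_Int_open[OF W(3), of "ball x r"] by simp
  moreover have "x \<in> edge_space E"
    using assms(7) by (simp add: equilibrium_set_def)
  then have "edge_act E \<sigma> ` (?X \<inter> ball x r) = ?X \<inter> ball x r"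
    using edge_act_image_equilibrium_set_Int_ball[of A E \<sigma> f] assms by blast
  ultimately show ?thesis
    \<comment> \<open>Being cut out by an open ball, the witness is relatively open in the
      equilibrium set.\<close>
    using assms(7) r(1) by (intro disjI2 exI[of _ "?X \<inter> ball x r"] exI[of _ d]) auto
next
  case False
  then show ?thesis
    using assms(7) by (simp add: singular_point_def)
qed

end
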